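(* Consider the GBSM problem as in the context, and suppose that for every partial solution an $\alpha$-list can be computed, where $\alpha\in(0,1]$. Then for any $\beta\ge1$ there exists an algorithm that guarantees a $\left[\frac12\left(1-\frac1{e^{\alpha\beta}}\right),\beta\right]$ bi-criterion approximation for GBSM, i.e. it returns $(S',X')$ with $S'\subseteq S$ nonempty, $X'\subseteq X$, $f(X')\ge\frac12\left(1-e^{-\alpha\beta}\right)f(X^* )$ and $c(S',X')\le\beta k$, where $(S^*,X^* )$ is an optimal solution of the GBSM instance with budget $k$.
   Context: GBSM: Let $X$ be a finite set of $n$ elements and $S$ a finite set of $m$ bins. Each bin $s\in S$ has a cost $c(s)\in\mathbb{R}_{\ge0}$, and for each $s\in S$, $x\in X$ there is a cost $c(s,x)\ge 0$ (possibly $+\infty$) of associating $x$ to $s$. Let $k\in\mathbb{R}_{\ge0}$ be a budget and $f:2^X\to\mathbb{R}_{\ge0}$ a monotone nondecreasing submodular function. For $S'\subseteq S$, $X'\subseteq X$ let $c(S',X')=\sum_{s\in S'}c(s)+\sum_{x\in X'}\min_{s\in S'}c(s,x)$. The problem is to find $X'\subseteq X$ and nonempty $S'\subseteq S$ with $c(S',X')\le k$ maximizing $f(X')$. For a partial solution $(S',X')$: $c_{S'}(s)=c(s)$ if $s\notin S'$ and $c_{S'}(s)=0$ if $s\in S'$; for $T\subseteq X\setminus X'$, $c_{\min}(T)=\min_{s\in S}\{c_{S'}(s)+\sum_{x\in T}c(s,x)\}$, $s_{\min}(T)$ is a bin attaining this minimum, and $g(T)=f(X'\cup T)-f(X')$.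 Let $\mathcal F=\{T\subseteq X\setminus X' : c(S'\cup\{s_{\min}(T)\},T)\le k\}$. A family $L\subseteq\mathcal F$ is an $\alpha$-list with respect to $(S',X')$ if $\max\{g(T)/c_{\min}(T): T\in L, c_{\min}(T)>0\}\ge \alpha\max\{g(T)/c_{\min}(T): T\in\mathcal F, c_{\min}(T)>0\}$. An algorithm gives a $[\rho,\beta]$ bi-criterion approximation if it always returns $(S',X')$ with $f(X')\ge\rho f(X^* )$ and $c(S',X')\le\beta k$. *)

theory Defs
  imports Complex_Main "HOL-Library.Extended_Nonnegative_Real"
begin

record ('x, 's) gbsm =
  items :: "'x set"
  bins :: "'s set"
  bin_cost :: "'s \<Rightarrow> real"
  assoc_cost :: "'s \<Rightarrow> 'x \<Rightarrow> ennreal"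
  budget :: real
  objective :: "'x set \<Rightarrow> real"

definition gbsm_instance :: "('x, 's) gbsm \<Rightarrow> bool" where
  "gbsm_instance I \<longleftrightarrow>
     finite (items I) \<and> finite (bins I) \<and>
     (\<forall>s\<in>bins I. 0 \<le> bin_cost I s) \<and> 0 \<le> budget I \<and>
     (\<forall>A. A \<subseteq> items I \<longrightarrow> 0 \<le> objective I A) \<and>
     (\<forall>A B. A \<subseteq> B \<and> B \<subseteq> items I \<longrightarrow> objective I A \<le> objective I B) \<and>
     (\<forall>A B. A \<subseteq> items I \<and> B \<subseteq> items I \<longrightarrow>
        objective I (A \<union> B) + objective I (A \<inter> B) \<le> objective I A + objective I B)"

text \<open>All minima and maxima below range over finite sets and are written as \<open>INF\<close> and \<open>SUP\<close> in
  \<^typ>\<open>ennreal\<close>. This only matters for empty ranges: the minimum is then \<open>\<infinity>\<close>, the maximum \<open>0\<close>.\<close>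

definition cost :: "('x, 's) gbsm \<Rightarrow> 's set \<Rightarrow> 'x set \<Rightarrow> ennreal" where
  "cost I S' X' =
     (\<Sum>s\<in>S'. ennreal (bin_cost I s)) + (\<Sum>x\<in>X'. INF s\<in>S'. assoc_cost I s x)"

definition feasible :: "('x, 's) gbsm \<Rightarrow> 's set \<Rightarrow> 'x set \<Rightarrow> bool" where
  "feasible I S' X' \<longleftrightarrow>
     S' \<subseteq> bins I \<and> S' \<noteq> {} \<and> X' \<subseteq> items I \<and> cost I S' X' \<le> ennreal (budget I)"

definition optimal :: "('x, 's) gbsm \<Rightarrow> 's set \<Rightarrow> 'x set \<Rightarrow> bool" where
  "optimal I S' X' \<longleftrightarrow>
     feasible I S' X' \<and> (\<forall>S'' X''. feasible I S'' X'' \<longrightarrow> objective I X'' \<le> objective I X')"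

definition residual_bin_cost :: "('x, 's) gbsm \<Rightarrow> 's set \<Rightarrow> 's \<Rightarrow> ennreal" where
  "residual_bin_cost I S' s = (if s \<in> S' then 0 else ennreal (bin_cost I s))"

definition ext_cost :: "('x, 's) gbsm \<Rightarrow> 's set \<Rightarrow> 'x set \<Rightarrow> 's \<Rightarrow> ennreal" where
  "ext_cost I S' T s = residual_bin_cost I S' s + (\<Sum>x\<in>T. assoc_cost I s x)"

definition cmin :: "('x, 's) gbsm \<Rightarrow> 's set \<Rightarrow> 'x set \<Rightarrow> ennreal" where
  "cmin I S' T = (INF s\<in>bins I. ext_cost I S' T s)"

text \<open>A tie-breaking rule \<open>smin\<close> selects, for given \<open>S'\<close> and \<open>T\<close>, a bin attaining the minimum.\<close>

definition is_smin :: "('x, 's) gbsm \<Rightarrow> ('s set \<Rightarrow> 'x set \<Rightarrow> 's) \<Rightarrow> bool" where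
  "is_smin I smin \<longleftrightarrow>
     (\<forall>S' T. bins I \<noteq> {} \<and> S' \<subseteq> bins I \<and> T \<subseteq> items I \<longrightarrow>
        smin S' T \<in> bins I \<and> ext_cost I S' T (smin S' T) = cmin I S' T)"

definition gain :: "('x, 's) gbsm \<Rightarrow> 'x set \<Rightarrow> 'x set \<Rightarrow> real" where
  "gain I X' T = objective I (X' \<union> T) - objective I X'"

definition extensions ::
  "('x, 's) gbsm \<Rightarrow> ('s set \<Rightarrow> 'x set \<Rightarrow> 's) \<Rightarrow> 's set \<Rightarrow> 'x set \<Rightarrow> 'x set set" where
  "extensions I smin S' X' =
     {T. T \<subseteq> items I - X' \<and> cost I (S' \<union> {smin S' T}) T \<le> ennreal (budget I)}"

definition best_ratio :: "('x, 's) gbsm \<Rightarrow> 's set \<Rightarrow> 'x set \<Rightarrow> 'x set set \<Rightarrow> ennreal" where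
  "best_ratio I S' X' \<T> =
     (SUP T\<in>{T \<in> \<T>. cmin I S' T > 0}. ennreal (gain I X' T) / cmin I S' T)"

definition alpha_list ::
  "('x, 's) gbsm \<Rightarrow> ('s set \<Rightarrow> 'x set \<Rightarrow> 's) \<Rightarrow> real \<Rightarrow> 's set \<Rightarrow> 'x set \<Rightarrow> 'x set set \<Rightarrow> bool" where
  "alpha_list I smin \<alpha> S' X' L \<longleftrightarrow>
     L \<subseteq> extensions I smin S' X' \<and>
     best_ratio I S' X' L \<ge> ennreal \<alpha> * best_ratio I S' X' (extensions I smin S' X')"

text \<open>An algorithm is a program of a small real-RAM language. A program is a finite syntactic object
  that does not depend on the problem instance. It reads the costs and the budget, evaluates \<open>f\<close> at
  sets that it has built, and may call a subroutine that returns a list of extensions of a partial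
  solution. Registers hold an item, a bin, an extended nonnegative real, a set of items, or a set
  of bins. Loops range over the items, over the bins, or over a list returned by the subroutine.
  Hence every program terminates, and the number of basic operations, evaluations of \<open>f\<close> and
  subroutine calls is polynomially bounded in the number of items, the number of bins and the
  maximal length of the returned lists. In particular, exhaustive search over all subsets
  of the items is not available.\<close>

text \<open>Set expressions are used for sets of items as well as for sets of bins.\<close>

datatype set_exp =
    EmptySet
  | SetReg nat
  | Singleton nat
  | UnionOf set_exp set_exp
  | DiffOf set_exp set_exp

datatype num_exp =
    Constant real
  | NumReg nat
  | Budget
  | BinCost nat
  | AssocCost nat nat
  | Objective set_exp
  | Plus num_exp num_exp
  | Minus num_exp num_exp
  | Times num_exp num_exp
  | Quotient num_exp num_exp

datatype test =
    LessThan num_exp num_exp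
  | ItemIn nat set_exp
  | BinIn nat set_exp
  | Negation test
  | Conjunction test test

datatype program =
    Skip
  | AssignNum nat num_exp
  | AssignItems nat set_exp
  | AssignBins nat set_exp
  | Seq program program
  | IfThenElse test program program
  | ForItem nat program
  | ForBin nat program
  | ForList nat set_exp set_exp program

record ('x, 's) state =
  item_reg :: "nat \<Rightarrow> 'x"
  bin_reg :: "nat \<Rightarrow> 's"
  num_reg :: "nat \<Rightarrow> ennreal"
  items_reg :: "nat \<Rightarrow> 'x set"
  bins_reg :: "nat \<Rightarrow> 's set"

primrec eval_set :: "(nat \<Rightarrow> 'a) \<Rightarrow> (nat \<Rightarrow> 'a set) \<Rightarrow> set_exp \<Rightarrow> 'a set" where
  "eval_set e r EmptySet = {}"
| "eval_set e r (SetReg i) = r i"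
| "eval_set e r (Singleton i) = {e i}"
| "eval_set e r (UnionOf a b) = eval_set e r a \<union> eval_set e r b"
| "eval_set e r (DiffOf a b) = eval_set e r a - eval_set e r b"

abbreviation eval_items :: "('x, 's) state \<Rightarrow> set_exp \<Rightarrow> 'x set" where
  "eval_items \<sigma> \<equiv> eval_set (item_reg \<sigma>) (items_reg \<sigma>)"

abbreviation eval_bins :: "('x, 's) state \<Rightarrow> set_exp \<Rightarrow> 's set" where
  "eval_bins \<sigma> \<equiv> eval_set (bin_reg \<sigma>) (bins_reg \<sigma>)"

text \<open>Subtraction is the truncated one of \<^typ>\<open>ennreal\<close>.\<close>

primrec eval_num :: "('x, 's) gbsm \<Rightarrow> ('x, 's) state \<Rightarrow> num_exp \<Rightarrow> ennreal" where
  "eval_num I \<sigma> (Constant r) = ennreal r"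
| "eval_num I \<sigma> (NumReg i) = num_reg \<sigma> i"
| "eval_num I \<sigma> Budget = ennreal (budget I)"
| "eval_num I \<sigma> (BinCost i) = ennreal (bin_cost I (bin_reg \<sigma> i))"
| "eval_num I \<sigma> (AssocCost i j) = assoc_cost I (bin_reg \<sigma> i) (item_reg \<sigma> j)"
| "eval_num I \<sigma> (Objective a) = ennreal (objective I (eval_items \<sigma> a))"
| "eval_num I \<sigma> (Plus a b) = eval_num I \<sigma> a + eval_num I \<sigma> b"
| "eval_num I \<sigma> (Minus a b) = eval_num I \<sigma> a - eval_num I \<sigma> b"
| "eval_num I \<sigma> (Times a b) = eval_num I \<sigma> a * eval_num I \<sigma> b"
| "eval_num I \<sigma> (Quotient a b) = eval_num I \<sigma> a / eval_num I \<sigma> b"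

primrec eval_test :: "('x, 's) gbsm \<Rightarrow> ('x, 's) state \<Rightarrow> test \<Rightarrow> bool" where
  "eval_test I \<sigma> (LessThan a b) \<longleftrightarrow> eval_num I \<sigma> a < eval_num I \<sigma> b"
| "eval_test I \<sigma> (ItemIn i a) \<longleftrightarrow> item_reg \<sigma> i \<in> eval_items \<sigma> a"
| "eval_test I \<sigma> (BinIn i a) \<longleftrightarrow> bin_reg \<sigma> i \<in> eval_bins \<sigma> a"
| "eval_test I \<sigma> (Negation t) \<longleftrightarrow> \<not> eval_test I \<sigma> t"
| "eval_test I \<sigma> (Conjunction t u) \<longleftrightarrow> eval_test I \<sigma> t \<and> eval_test I \<sigma> u"

text \<open>\<open>xs\<close> and \<open>ss\<close> are the orders in which the items and the bins are presented to the program;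
  \<open>lst S' X'\<close> is the list returned by the subroutine for the partial solution \<open>(S', X')\<close>.\<close>

primrec exec ::
  "('x, 's) gbsm \<Rightarrow> 'x list \<Rightarrow> 's list \<Rightarrow> ('s set \<Rightarrow> 'x set \<Rightarrow> 'x set list) \<Rightarrow>
   program \<Rightarrow> ('x, 's) state \<Rightarrow> ('x, 's) state" where
  "exec I xs ss lst Skip \<sigma> = \<sigma>"
| "exec I xs ss lst (AssignNum i a) \<sigma> = \<sigma>\<lparr>num_reg := (num_reg \<sigma>)(i := eval_num I \<sigma> a)\<rparr>"
| "exec I xs ss lst (AssignItems i a) \<sigma> = \<sigma>\<lparr>items_reg := (items_reg \<sigma>)(i := eval_items \<sigma> a)\<rparr>"
| "exec I xs ss lst (AssignBins i a) \<sigma> = \<sigma>\<lparr>bins_reg := (bins_reg \<sigma>)(i := eval_bins \<sigma> a)\<rparr>"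
| "exec I xs ss lst (Seq p q) \<sigma> = exec I xs ss lst q (exec I xs ss lst p \<sigma>)"
| "exec I xs ss lst (IfThenElse t p q) \<sigma> =
     (if eval_test I \<sigma> t then exec I xs ss lst p \<sigma> else exec I xs ss lst q \<sigma>)"
| "exec I xs ss lst (ForItem i p) \<sigma> =
     fold (\<lambda>x \<tau>. exec I xs ss lst p (\<tau>\<lparr>item_reg := (item_reg \<tau>)(i := x)\<rparr>)) xs \<sigma>"
| "exec I xs ss lst (ForBin i p) \<sigma> =
     fold (\<lambda>s \<tau>. exec I xs ss lst p (\<tau>\<lparr>bin_reg := (bin_reg \<tau>)(i := s)\<rparr>)) ss \<sigma>"
| "exec I xs ss lst (ForList i a b p) \<sigma> =
     fold (\<lambda>T \<tau>. exec I xs ss lst p (\<tau>\<lparr>items_reg := (items_reg \<tau>)(i := T)\<rparr>))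
       (lst (eval_bins \<sigma> a) (eval_items \<sigma> b)) \<sigma>"

definition initial_state :: "('x, 's) state" where
  "initial_state =
     \<lparr>item_reg = (\<lambda>_. undefined), bin_reg = (\<lambda>_. undefined), num_reg = (\<lambda>_. 0),
      items_reg = (\<lambda>_. {}), bins_reg = (\<lambda>_. {})\<rparr>"

text \<open>The output is read off the two set registers with index \<open>0\<close>.\<close>

definition run ::
  "('x, 's) gbsm \<Rightarrow> 'x list \<Rightarrow> 's list \<Rightarrow> ('s set \<Rightarrow> 'x set \<Rightarrow> 'x set list) \<Rightarrow>
   program \<Rightarrow> 's set \<times> 'x set" where
  "run I xs ss lst p =
     (let \<sigma> = exec I xs ss lst p initial_state in (bins_reg \<sigma> 0, items_reg \<sigma> 0))"

text \<open>Instances without a feasible solution impose no condition on the output.\<close>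

definition bicriterion_solution ::
  "('x, 's) gbsm \<Rightarrow> real \<Rightarrow> real \<Rightarrow> 's set \<times> 'x set \<Rightarrow> bool" where
  "bicriterion_solution I \<rho> \<beta> = (\<lambda>(S', X').
     \<forall>S_opt X_opt. optimal I S_opt X_opt \<longrightarrow>
       S' \<subseteq> bins I \<and> S' \<noteq> {} \<and> X' \<subseteq> items I \<and>
       objective I X' \<ge> \<rho> * objective I X_opt \<and>
       cost I S' X' \<le> ennreal (\<beta> * budget I))"

end

theory Submission
  imports Defs
begin

text \<open>The greedy algorithm only ever asks for extensions of partial solutions \<open>({}, X)\<close>. The
  family \<^const>\<open>extensions\<close> of \<open>(S, X)\<close> charges the bins of \<open>S\<close> again, so for \<open>S \<noteq> {}\<close> it may miss
  the parts into which the optimal bins divide the optimal items; for \<open>S = {}\<close> it contains all of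
  them, and their minimal costs still add up to at most the budget \<open>k\<close>. Hence, once all items that
  cost nothing are present, some listed extension of cost \<open>c\<close> shrinks the gap \<open>f(X_opt) - f(X)\<close> by
  the factor \<open>1 - \<alpha> c / k \<le> exp (- \<alpha> c / k)\<close>. Adding it, together with one bin, raises the cost by at
  most \<open>c\<close>. When the best extension \<open>T\<close> would push the total over \<open>\<beta> k\<close>, the set \<open>X \<union> T\<close> already
  satisfies the bound without the factor \<open>1/2\<close>, and by submodularity the better of \<open>X\<close> and \<open>T\<close> (each
  affordable on its own) retains half of it.\<close>

subsection \<open>Combinatorics of a greedy step\<close>

lemma finite_INF_attained:
  fixes h :: "'a \<Rightarrow> 'b :: complete_linorder"
  assumes "finite A" "A \<noteq> {}"
  shows "\<exists>a\<in>A. h a = (INF a\<in>A. h a)"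
proof -
  have "Min (h ` A) \<in> h ` A" using assms by (intro Min_in) auto
  then show ?thesis using assms by (auto simp: Min_Inf)
qed

section \<open>Subadditivity of gains and costs\<close>

lemma gain_nonneg:
  assumes "gbsm_instance I" "X \<subseteq> items I" "T \<subseteq> items I"
  shows "0 \<le> gain I X T"
  using assms unfolding gbsm_instance_def gain_def by simp

text \<open>Submodularity at \<open>X \<union> A\<close> and \<open>X \<union> B\<close>: their
  intersection contains \<open>X\<close>, so by monotonicity it is worth at least
  \<open>objective I X\<close>.\<close>

lemma gain_Un_le:
  assumes I: "gbsm_instance I" and sub: "X \<subseteq> items I" "A \<subseteq> items I" "B \<subseteq> items I"
  shows "gain I X (A \<union> B) \<le> gain I X A + gain I X B"
proof -
  have "objective I ((X \<union> A) \<union> (X \<union> B)) + objective I ((X \<union> A) \<inter> (X \<union> B))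
      \<le> objective I (X \<union> A) + objective I (X \<union> B)"
    using I sub unfolding gbsm_instance_def by (metis Un_least)
  moreover have "objective I X \<le> objective I ((X \<union> A) \<inter> (X \<union> B))"
  proof -
    have "X \<subseteq> (X \<union> A) \<inter> (X \<union> B)" "(X \<union> A) \<inter> (X \<union> B) \<subseteq> items I" using sub by auto
    then show ?thesis using I unfolding gbsm_instance_def by blast
  qed
  moreover have "(X \<union> A) \<union> (X \<union> B) = X \<union> (A \<union> B)" by auto
  ultimately show ?thesis unfolding gain_def by simp
qed

lemma gain_UN_le:
  assumes I: "gbsm_instance I" and X: "X \<subseteq> items I" and "finite A"
    and "\<And>s. s \<in> A \<Longrightarrow> T s \<subseteq> items I"
  shows "gain I X (\<Union>s\<in>A. T s) \<le> (\<Sum>s\<in>A. gain I X (T s))"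
  using assms(3,4)
proof (induction A rule: finite_induct)
  case empty
  then show ?case by (simp add: gain_def)
next
  case (insert s A)
  have "gain I X (T s \<union> (\<Union>s\<in>A. T s)) \<le> gain I X (T s) + gain I X (\<Union>s\<in>A. T s)"
    using insert.prems by (intro gain_Un_le[OF I X]) auto
  also have "gain I X (\<Union>s\<in>A. T s) \<le> (\<Sum>s\<in>A. gain I X (T s))"
    using insert by auto
  finally show ?case using insert.hyps by simp
qed

text \<open>Extra bins can only lower the association minima. Charging \<open>s\<close> in full,
  even when \<open>s \<in> S\<close>, allows the new items to be priced relative to the empty bin
  set.\<close>

lemma cost_Un_le:
  assumes "finite S" "finite X" "finite T"
  shows "cost I (S \<union> {s}) (X \<union> T) \<le> cost I S X + ext_cost I {} T s"
proof -
  let ?d = "\<lambda>x. INF s\<in>S \<union> {s}. assoc_cost I s x"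
  have "(\<Sum>s\<in>S \<union> {s}. ennreal (bin_cost I s))
      \<le> (\<Sum>s\<in>S. ennreal (bin_cost I s)) + ennreal (bin_cost I s)"
    using assms(1) by (simp add: sum.insert_if add.commute)
  moreover have "sum ?d (X \<union> T) \<le> sum ?d X + sum ?d T"
    unfolding sum.union_inter[OF assms(2,3), of ?d, symmetric] by simp
  moreover have "sum ?d X \<le> (\<Sum>x\<in>X. INF s\<in>S. assoc_cost I s x)"
    by (intro sum_mono INF_superset_mono) auto
  moreover have "sum ?d T \<le> (\<Sum>x\<in>T. assoc_cost I s x)"
    by (intro sum_mono INF_lower) auto
  ultimately have "cost I (S \<union> {s}) (X \<union> T)
      \<le> ((\<Sum>s\<in>S. ennreal (bin_cost I s)) + ennreal (bin_cost I s))
        + ((\<Sum>x\<in>X. INF s\<in>S. assoc_cost I s x) + (\<Sum>x\<in>T. assoc_cost I s x))"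
    unfolding cost_def by (meson add_mono order_trans)
  then show ?thesis
    unfolding cost_def ext_cost_def residual_bin_cost_def by (simp add: ac_simps)
qed

lemma cost_singleton: "cost I {s} T = ext_cost I {} T s"
  by (simp add: cost_def ext_cost_def residual_bin_cost_def)

text \<open>With one bin the association minimum is trivial, so the cost of
  \<open>{smin {} T}\<close> is \<open>cmin I {} T\<close>. The condition no longer depends on
  tie-breaking, and the price of \<open>T\<close> at any bin bounds it from above.\<close>

lemma extensions_empty:
  assumes "is_smin I smin" "bins I \<noteq> {}"
  shows "extensions I smin {} X = {T. T \<subseteq> items I - X \<and> cmin I {} T \<le> ennreal (budget I)}"
proof -
  have "cost I {smin {} T} T = cmin I {} T" if "T \<subseteq> items I" for T
    using assms that unfolding is_smin_def cost_singleton by blast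
  then have "cost I ({} \<union> {smin {} T}) T = cmin I {} T" if "T \<subseteq> items I - X" for T
    using that by auto
  then show ?thesis unfolding extensions_def by (intro Collect_cong) metis
qed

section \<open>Free items and the averaging bound\<close>

definition free_items :: "('x, 's) gbsm \<Rightarrow> 'x set" where
  "free_items I = {x \<in> items I. \<exists>s\<in>bins I. bin_cost I s = 0 \<and> assoc_cost I s x = 0}"

text \<open>Since \<open>best_ratio\<close> skips sets of minimal cost zero, such sets must not hide
  any gain. A bin serving \<open>T\<close> at total cost zero makes every item of \<open>T\<close>
  free, and free items are already in \<open>X\<close>.\<close>

lemma cmin_empty_pos:
  assumes I: "gbsm_instance I" and bins: "bins I \<noteq> {}"
    and T: "T \<subseteq> items I - X" "T \<noteq> {}" and free: "free_items I \<subseteq> X"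
  shows "0 < cmin I {} T"
proof (rule ccontr)
  assume "\<not> 0 < cmin I {} T"
  then have "cmin I {} T = 0" by (simp add: not_gr_zero)
  moreover have fin: "finite (bins I)" "finite T"
    using I T finite_subset[of T "items I"] unfolding gbsm_instance_def by auto
  ultimately obtain s where s: "s \<in> bins I" "ext_cost I {} T s = 0"
    using finite_INF_attained[of "bins I" "ext_cost I {} T"] bins unfolding cmin_def by auto
  then have "bin_cost I s = 0" "\<forall>x\<in>T. assoc_cost I s x = 0"
    using I fin unfolding ext_cost_def residual_bin_cost_def gbsm_instance_def
    by (auto simp: ennreal_eq_0_iff intro: antisym)
  then have "T \<subseteq> free_items I" using s T unfolding free_items_def by auto
  then show False using T free by auto
qed

text \<open>Averaging over the optimal bins: the optimal items outside \<open>X\<close> are split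
  among them, the gains of the parts add up to at least the gap, and their costs to at most the
  budget.\<close>

lemma gap_le_best_ratio:
  assumes I: "gbsm_instance I" and smin: "is_smin I smin" and opt: "feasible I S_opt X_opt"
    and X: "X \<subseteq> items I" and free: "free_items I \<subseteq> X"
  shows "ennreal (objective I X_opt - objective I X)
    \<le> best_ratio I {} X (extensions I smin {} X) * ennreal (budget I)"
proof -
  let ?R = "best_ratio I {} X (extensions I smin {} X)"
  have bins: "bins I \<noteq> {}" and S: "S_opt \<subseteq> bins I" "S_opt \<noteq> {}" "X_opt \<subseteq> items I"
    and le: "cost I S_opt X_opt \<le> ennreal (budget I)"
    using opt unfolding feasible_def by auto
  have fin: "finite S_opt" "finite X_opt"
    using S I unfolding gbsm_instance_def by (auto intro: finite_subset)
  have "\<exists>s\<in>S_opt. assoc_cost I s x = (INF s\<in>S_opt. assoc_cost I s x)" for x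
    using fin S by (intro finite_INF_attained)
  \<comment> \<open>\<open>b\<close> sends each item to an optimal bin serving it most cheaply, so
    splitting along \<open>b\<close> reproduces the association costs of the optimal
    solution.\<close>
  then obtain b where b: "\<And>x. b x \<in> S_opt"
    "\<And>x. assoc_cost I (b x) x = (INF s\<in>S_opt. assoc_cost I s x)"
    by metis
  define T where "T s = {x \<in> X_opt - X. b x = s}" for s
  have T: "T s \<subseteq> items I - X" for s using S unfolding T_def by auto
  have "(\<Sum>s\<in>S_opt. ext_cost I {} (T s) s)
      = (\<Sum>s\<in>S_opt. ennreal (bin_cost I s)) + (\<Sum>s\<in>S_opt. \<Sum>x\<in>T s. assoc_cost I (b x) x)"
    unfolding ext_cost_def residual_bin_cost_def sum.distrib by (simp add: T_def)
  also have "(\<Sum>s\<in>S_opt. \<Sum>x\<in>T s. assoc_cost I (b x) x) = (\<Sum>x\<in>X_opt - X. assoc_cost I (b x) x)"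
    unfolding T_def using fin b by (intro sum.group) auto
  also have "\<dots> \<le> (\<Sum>x\<in>X_opt. assoc_cost I (b x) x)"
    using fin by (intro sum_mono2) auto
  finally have total: "(\<Sum>s\<in>S_opt. ext_cost I {} (T s) s) \<le> ennreal (budget I)"
    using le unfolding cost_def b(2) by (meson add_left_mono order_trans)
  have part: "ennreal (gain I X (T s)) \<le> ?R * ext_cost I {} (T s) s" if s: "s \<in> S_opt" for s
  proof (cases "T s = {}")
    case True
    then show ?thesis by (simp add: gain_def)
  next
    case False
    let ?c = "cmin I {} (T s)"
    have pos: "0 < ?c" using cmin_empty_pos[OF I bins T False free] .
    have c_le: "?c \<le> ext_cost I {} (T s) s"
      unfolding cmin_def using s S by (intro INF_lower) auto
    also have "\<dots> \<le> (\<Sum>s\<in>S_opt. ext_cost I {} (T s) s)"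
      using s fin by (intro member_le_sum) auto
    \<comment> \<open>One part costs at most as much as all parts together. This puts
      \<open>T s\<close> among the extensions and keeps its minimal cost finite, so that the
      division below can be undone.\<close>
    finally have ck: "?c \<le> ennreal (budget I)" using total by simp
    then have "?c < \<infinity>" using le_less_trans by fastforce
    moreover have "ennreal (gain I X (T s)) / ?c \<le> ?R"
      unfolding best_ratio_def using T ck pos
      by (intro SUP_upper2[of "T s"]) (auto simp: extensions_empty[OF smin bins])
    moreover have "ennreal (gain I X (T s)) / ?c * ?c = ennreal (gain I X (T s))"
      using pos \<open>?c < \<infinity>\<close> by (simp add: ennreal_divide_times ennreal_mult_divide_eq)
    ultimately have "ennreal (gain I X (T s)) \<le> ?R * ?c"
      by (metis mult_right_mono zero_le)
    also have "\<dots> \<le> ?R * ext_cost I {} (T s) s" using c_le by (simp add: mult_left_mono)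
    finally show ?thesis .
  qed
  have nonneg: "0 \<le> gain I X (T s)" for s
    using T[of s] by (intro gain_nonneg[OF I X]) auto
  have "objective I X_opt - objective I X \<le> gain I X (X_opt - X)"
  proof -
    have "X_opt \<subseteq> X \<union> (X_opt - X)" "X \<union> (X_opt - X) \<subseteq> items I" using X S by auto
    then show ?thesis using I unfolding gain_def gbsm_instance_def by fastforce
  qed
  also have "X_opt - X = (\<Union>s\<in>S_opt. T s)" using b(1) unfolding T_def by auto
  also have "gain I X \<dots> \<le> (\<Sum>s\<in>S_opt. gain I X (T s))"
    using T by (intro gain_UN_le I X fin) blast
  finally have "ennreal (objective I X_opt - objective I X) \<le> (\<Sum>s\<in>S_opt. ennreal (gain I X (T s)))"
    using nonneg by (simp add: sum_ennreal ennreal_leI)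
  also have "\<dots> \<le> (\<Sum>s\<in>S_opt. ?R * ext_cost I {} (T s) s)"
    using part by (intro sum_mono)
  also have "\<dots> \<le> ?R * ennreal (budget I)"
    using total unfolding sum_distrib_left[symmetric] by (rule mult_left_mono) simp
  finally show ?thesis .
qed

text \<open>Here \<open>d\<close> is the gap, \<open>w\<close> the cost paid so far, and
  \<open>g\<close>, \<open>c\<close> are gain and cost of the chosen extension. The two bounds on
  \<open>R\<close> combine to \<open>\<alpha> * d \<le> g / c * k\<close>; then
  \<open>1 - t \<le> exp (- t)\<close> applies with \<open>t = \<alpha> * c / k\<close>.\<close>

lemma gap_decay:
  fixes d g c k \<alpha> F w :: real
  assumes R: "ennreal d \<le> R * ennreal k" "ennreal \<alpha> * R \<le> ennreal g / ennreal c"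
    and pos: "0 < c" "0 < k" "0 < \<alpha>" "0 \<le> g" "0 \<le> F" and d: "d \<le> exp (- \<alpha> * w / k) * F"
  shows "d - g \<le> exp (- \<alpha> * (w + c) / k) * F"
\<comment> \<open>Under the relaxed budget the current set may beat the optimum. Then
  \<open>ennreal d\<close> is \<open>0\<close> and the first bound on \<open>R\<close> carries no
  information, but the right-hand side is nonnegative.\<close>
proof (cases "0 \<le> d")
  case False
  then have "d - g \<le> 0" using pos by simp
  also have "0 \<le> exp (- \<alpha> * (w + c) / k) * F" using pos by simp
  finally show ?thesis .
next
  case True
  have "ennreal (\<alpha> * d) = ennreal \<alpha> * ennreal d" using True pos by (simp add: ennreal_mult)
  also have "\<dots> \<le> (ennreal \<alpha> * R) * ennreal k" using R(1) by (simp add: mult.assoc mult_left_mono)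
  also have "\<dots> \<le> ennreal g / ennreal c * ennreal k" using R(2) by (rule mult_right_mono) simp
  also have "\<dots> = ennreal (g / c * k)" using pos by (simp add: divide_ennreal ennreal_mult[symmetric])
  finally have "\<alpha> * d \<le> g / c * k" using pos by (simp add: ennreal_le_iff)
  then have g: "\<alpha> * c / k * d \<le> g" using pos by (simp add: field_simps)
  have "d - g \<le> (1 - \<alpha> * c / k) * d" using g by (simp add: left_diff_distrib)
  also have "\<dots> \<le> exp (- (\<alpha> * c / k)) * d"
    using exp_ge_add_one_self[of "- (\<alpha> * c / k)"] True by (intro mult_right_mono) auto
  also have "\<dots> \<le> exp (- (\<alpha> * c / k)) * (exp (- \<alpha> * w / k) * F)"
    using d by (intro mult_left_mono) auto
  also have "\<dots> = exp (- \<alpha> * (w + c) / k) * F"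
  proof -
    have "- \<alpha> * (w + c) / k = - (\<alpha> * c / k) + - \<alpha> * w / k"
      by (simp add: diff_divide_distrib distrib_left)
    then show ?thesis by (simp only: exp_add mult.assoc)
  qed
  finally show ?thesis .
qed

subsection \<open>The program\<close>

text \<open>Registers: item sets \<open>0\<close> (output), \<open>1\<close> (scanned extension), \<open>2\<close> (best extension),
  \<open>3\<close> (reserve); bin sets \<open>0\<close> (output), \<open>1\<close>, \<open>2\<close>, \<open>3\<close> (bins of the best extension, of the reserve
  and of the scanned extension); numbers \<open>0\<close> (cost paid so far), \<open>1\<close>, \<open>2\<close> (ratio and minimal cost of
  the best extension), \<open>3\<close> (minimal cost of the scanned extension), \<open>4\<close> (scratch).\<close>

definition find_bin :: program where
  "find_bin =
     Seq (AssignNum 3 (Quotient (Constant 1) (Constant 0)))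
     (ForBin 0
       (Seq (AssignNum 4 (BinCost 0))
       (Seq (ForItem 0
          (IfThenElse (ItemIn 0 (SetReg 1)) (AssignNum 4 (Plus (NumReg 4) (AssocCost 0 0))) Skip))
       (IfThenElse (LessThan (NumReg 3) (NumReg 4)) Skip
          (Seq (AssignNum 3 (NumReg 4)) (AssignBins 3 (Singleton 0)))))))"

definition scanned_ratio :: num_exp where
  "scanned_ratio =
     Quotient (Minus (Objective (UnionOf (SetReg 0) (SetReg 1))) (Objective (SetReg 0))) (NumReg 3)"

definition find_extension :: program where
  "find_extension =
     Seq (AssignNum 1 (Constant 0))
     (ForList 1 EmptySet (SetReg 0)
       (Seq find_bin
       (IfThenElse (Conjunction (LessThan (Constant 0) (NumReg 3)) (LessThan (NumReg 1) scanned_ratio))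
         (Seq (AssignNum 1 scanned_ratio)
         (Seq (AssignNum 2 (NumReg 3))
         (Seq (AssignItems 2 (SetReg 1)) (AssignBins 1 (SetReg 3)))))
         Skip)))"

text \<open>An extension that does not fit becomes the reserve while the solution stays the same.
  Later rounds then repeat this choice, so the loop idles without a stopping flag.\<close>

definition greedy_round :: "real \<Rightarrow> program" where
  "greedy_round \<beta> =
     Seq find_extension
     (IfThenElse (LessThan (Constant 0) (NumReg 1))
       (IfThenElse (LessThan (Times (Constant \<beta>) Budget) (Plus (NumReg 0) (NumReg 2)))
         (Seq (AssignItems 3 (SetReg 2)) (AssignBins 2 (SetReg 1)))
         (Seq (AssignItems 0 (UnionOf (SetReg 0) (SetReg 2)))
         (Seq (AssignBins 0 (UnionOf (SetReg 0) (SetReg 1)))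
           (AssignNum 0 (Plus (NumReg 0) (NumReg 2))))))
       Skip)"

text \<open>An affordable bin with no items is a valid reserve until an extension overflows.\<close>

definition reserve_bin :: program where
  "reserve_bin =
     ForBin 0 (IfThenElse (LessThan Budget (BinCost 0)) Skip (AssignBins 2 (Singleton 0)))"

definition add_free_of_bin :: program where
  "add_free_of_bin =
     Seq (AssignBins 0 (UnionOf (SetReg 0) (Singleton 0)))
       (ForItem 0 (IfThenElse (LessThan (Constant 0) (AssocCost 0 0)) Skip
         (AssignItems 0 (UnionOf (SetReg 0) (Singleton 0)))))"

definition add_free :: program where
  "add_free = ForBin 0 (IfThenElse (LessThan (Constant 0) (BinCost 0)) Skip add_free_of_bin)"

text \<open>The loop over the items is a counter: each round that extends the solution adds an item.
  Ties go to the reserve, which owns a bin whenever the instance is feasible; the other candidate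
  must win strictly, hence with a nonempty item set.\<close>

definition greedy :: "real \<Rightarrow> program" where
  "greedy \<beta> =
     Seq reserve_bin
     (Seq add_free
     (Seq (ForItem 1 (greedy_round \<beta>))
     (IfThenElse (LessThan (Objective (SetReg 3)) (Objective (SetReg 0))) Skip
       (Seq (AssignItems 0 (SetReg 3)) (AssignBins 0 (SetReg 2))))))"

section \<open>Correctness of the scans over items, bins and extensions\<close>

text \<open>Invariants are indexed by the processed prefix. The split
  \<open>xs = ys @ y # zs\<close> shows that \<open>y\<close> belongs to the list and, for distinct
  lists, that it is new.\<close>

lemma fold_prefix_induct [consumes 0, case_names Nil snoc]:
  assumes "P [] a"
    and "\<And>ys y zs b. xs = ys @ y # zs \<Longrightarrow> P ys b \<Longrightarrow> P (ys @ [y]) (h y b)"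
  shows "P xs (fold h xs a)"
proof -
  have "P ys (fold h ys a)" if "xs = ys @ zs" for ys zs
    using that
  proof (induction ys arbitrary: zs rule: rev_induct)
    case Nil
    then show ?case using assms(1) by simp
  next
    case (snoc y ys)
    then show ?case using assms(2)[of ys y zs] by simp
  qed
  then show ?thesis by simp
qed

locale greedy_input =
  fixes I :: "('x, 's) gbsm" and xs :: "'x list" and ss :: "'s list"
    and smin :: "'s set \<Rightarrow> 'x set \<Rightarrow> 's" and lst :: "'s set \<Rightarrow> 'x set \<Rightarrow> 'x set list"
    and \<alpha> \<beta> :: real
  assumes I: "gbsm_instance I"
    and xs: "distinct xs" "set xs = items I"
    and ss: "set ss = bins I"
    and smin: "is_smin I smin"
    and lst: "\<And>S X. S \<subseteq> bins I \<Longrightarrow> X \<subseteq> items I \<Longrightarrow> alpha_list I smin \<alpha> S X (set (lst S X))"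
    and \<alpha>: "0 < \<alpha>" and \<beta>: "1 \<le> \<beta>"
begin

lemma exec_sum_assoc:
  fixes \<sigma> :: "('x, 's) state"
  assumes "T \<subseteq> items I" "items_reg \<sigma> 1 = T"
  defines "\<tau> \<equiv> exec I xs ss lst (ForItem 0
      (IfThenElse (ItemIn 0 (SetReg 1)) (AssignNum 4 (Plus (NumReg 4) (AssocCost 0 0))) Skip)) \<sigma>"
  shows "items_reg \<tau> = items_reg \<sigma>" "bins_reg \<tau> = bins_reg \<sigma>" "bin_reg \<tau> = bin_reg \<sigma>"
    "num_reg \<tau> = (num_reg \<sigma>)(4 := num_reg \<sigma> 4 + (\<Sum>x\<in>T. assoc_cost I (bin_reg \<sigma> 0) x))"
proof -
  define h where "h = (\<lambda>x (\<tau> :: ('x, 's) state). exec I xs ss lst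
      (IfThenElse (ItemIn 0 (SetReg 1)) (AssignNum 4 (Plus (NumReg 4) (AssocCost 0 0))) Skip)
      (\<tau>\<lparr>item_reg := (item_reg \<tau>)(0 := x)\<rparr>))"
  define P where "P = (\<lambda>ys (\<tau> :: ('x, 's) state).
    items_reg \<tau> = items_reg \<sigma> \<and> bins_reg \<tau> = bins_reg \<sigma> \<and> bin_reg \<tau> = bin_reg \<sigma> \<and>
    num_reg \<tau> = (num_reg \<sigma>)(4 := num_reg \<sigma> 4 + (\<Sum>x\<in>T \<inter> set ys. assoc_cost I (bin_reg \<sigma> 0) x)))"
  have "P xs (fold h xs \<sigma>)"
  proof (induction rule: fold_prefix_induct)
    case Nil
    then show ?case by (simp add: P_def)
  next
    case (snoc ys y zs \<tau>)
    \<comment> \<open>Distinctness ensures that no association cost is added twice.\<close>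
    then have "y \<notin> set ys" using xs by auto
    then show ?case using snoc assms(2) unfolding P_def h_def
      by (auto simp: fun_eq_iff Int_insert_right ac_simps)
  qed
  moreover have "T \<inter> set xs = T" using assms(1) xs by auto
  moreover have "\<tau> = fold h xs \<sigma>" unfolding \<tau>_def h_def by simp
  ultimately show "items_reg \<tau> = items_reg \<sigma>" "bins_reg \<tau> = bins_reg \<sigma>" "bin_reg \<tau> = bin_reg \<sigma>"
    "num_reg \<tau> = (num_reg \<sigma>)(4 := num_reg \<sigma> 4 + (\<Sum>x\<in>T. assoc_cost I (bin_reg \<sigma> 0) x))"
    unfolding P_def by auto
qed

lemma exec_find_bin:
  fixes \<sigma> :: "('x, 's) state"
  assumes "T \<subseteq> items I" "items_reg \<sigma> 1 = T" "bins I \<noteq> {}"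
  defines "\<tau> \<equiv> exec I xs ss lst find_bin \<sigma>"
  shows "items_reg \<tau> = items_reg \<sigma>" "\<And>i. i \<noteq> 3 \<Longrightarrow> bins_reg \<tau> i = bins_reg \<sigma> i"
    "\<And>i. i \<noteq> 3 \<Longrightarrow> i \<noteq> 4 \<Longrightarrow> num_reg \<tau> i = num_reg \<sigma> i"
    "num_reg \<tau> 3 = cmin I {} T"
    "\<exists>s\<in>bins I. bins_reg \<tau> 3 = {s} \<and> ext_cost I {} T s = cmin I {} T"
proof -
  define h where "h = (\<lambda>s (\<tau> :: ('x, 's) state). exec I xs ss lst
       (Seq (AssignNum 4 (BinCost 0))
       (Seq (ForItem 0
          (IfThenElse (ItemIn 0 (SetReg 1)) (AssignNum 4 (Plus (NumReg 4) (AssocCost 0 0))) Skip))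
       (IfThenElse (LessThan (NumReg 3) (NumReg 4)) Skip
          (Seq (AssignNum 3 (NumReg 4)) (AssignBins 3 (Singleton 0))))))
      (\<tau>\<lparr>bin_reg := (bin_reg \<tau>)(0 := s)\<rparr>))"
  define \<sigma>1 where "\<sigma>1 = \<sigma>\<lparr>num_reg := (num_reg \<sigma>)(3 := \<infinity>)\<rparr>"
  define P where "P = (\<lambda>ys (\<tau> :: ('x, 's) state).
    items_reg \<tau> = items_reg \<sigma> \<and> (\<forall>i. i \<noteq> 3 \<longrightarrow> bins_reg \<tau> i = bins_reg \<sigma> i) \<and>
    (\<forall>i. i \<noteq> 3 \<longrightarrow> i \<noteq> 4 \<longrightarrow> num_reg \<tau> i = num_reg \<sigma> i) \<and>
    num_reg \<tau> 3 = (INF s\<in>set ys. ext_cost I {} T s) \<and>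
    (ys \<noteq> [] \<longrightarrow> (\<exists>s\<in>set ys. bins_reg \<tau> 3 = {s} \<and> ext_cost I {} T s = num_reg \<tau> 3)))"
  have "P ss (fold h ss \<sigma>1)"
  proof (induction rule: fold_prefix_induct)
    case Nil
    then show ?case by (simp add: P_def \<sigma>1_def)
  next
    case (snoc ys s zs \<tau>)
    define \<tau>1 where "\<tau>1 = \<tau>\<lparr>bin_reg := (bin_reg \<tau>)(0 := s),
       num_reg := (num_reg \<tau>)(4 := ennreal (bin_cost I s))\<rparr>"
    have "items_reg \<tau>1 1 = T" using snoc assms(2) unfolding \<tau>1_def P_def by simp
    note sum = exec_sum_assoc[OF assms(1) this]
    define \<tau>2 where "\<tau>2 = exec I xs ss lst (ForItem 0
      (IfThenElse (ItemIn 0 (SetReg 1)) (AssignNum 4 (Plus (NumReg 4) (AssocCost 0 0))) Skip)) \<tau>1"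
    note sum = sum[folded \<tau>2_def]
    have h: "h s \<tau> = (if num_reg \<tau>2 3 < num_reg \<tau>2 4 then \<tau>2
      else \<tau>2\<lparr>num_reg := (num_reg \<tau>2)(3 := num_reg \<tau>2 4),
         bins_reg := (bins_reg \<tau>2)(3 := {bin_reg \<tau>2 0})\<rparr>)"
      unfolding h_def \<tau>2_def \<tau>1_def by simp
    have 4: "num_reg \<tau>2 4 = ext_cost I {} T s"
      unfolding sum by (simp add: \<tau>1_def ext_cost_def residual_bin_cost_def)
    have 3: "num_reg \<tau>2 3 = num_reg \<tau> 3" unfolding sum by (simp add: \<tau>1_def)
    have b: "bin_reg \<tau>2 0 = s" unfolding sum by (simp add: \<tau>1_def)
    have INF: "(INF s\<in>set (ys @ [s]). ext_cost I {} T s)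
       = min (ext_cost I {} T s) (INF s\<in>set ys. ext_cost I {} T s)"
      by (simp add: inf_min)
    have frame: "items_reg \<tau>2 = items_reg \<tau>" "bins_reg \<tau>2 = bins_reg \<tau>"
        "\<And>i. i \<noteq> 4 \<Longrightarrow> num_reg \<tau>2 i = num_reg \<tau> i"
      unfolding sum by (simp_all add: \<tau>1_def)
    show ?case
    proof (cases "num_reg \<tau> 3 < ext_cost I {} T s")
      case True
      \<comment> \<open>Over the empty prefix the infimum is \<infinity>, which nothing exceeds; so
        a bin has been stored already.\<close>
      then have "ys \<noteq> []" using snoc unfolding P_def by (auto simp: top_unique)
      then show ?thesis using snoc True unfolding P_def h INF 3 4 by (auto simp: frame)
    next
      case False
      then show ?thesis using snoc unfolding P_def h INF 3 4 b by (auto simp: frame min_def)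
    qed
  qed
  moreover have "\<tau> = fold h ss \<sigma>1"
    unfolding \<tau>_def h_def \<sigma>1_def find_bin_def by (simp add: ennreal_divide_zero)
  moreover have "ss \<noteq> []" using assms(3) ss by auto
  ultimately show "items_reg \<tau> = items_reg \<sigma>" "\<And>i. i \<noteq> 3 \<Longrightarrow> bins_reg \<tau> i = bins_reg \<sigma> i"
    "\<And>i. i \<noteq> 3 \<Longrightarrow> i \<noteq> 4 \<Longrightarrow> num_reg \<tau> i = num_reg \<sigma> i"
    "num_reg \<tau> 3 = cmin I {} T"
    "\<exists>s\<in>bins I. bins_reg \<tau> 3 = {s} \<and> ext_cost I {} T s = cmin I {} T"
    unfolding P_def cmin_def ss[symmetric] by auto
qed

text \<open>The last claim is conditional because a final ratio \<open>0\<close> means that nothing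
  was recorded in this call and the registers hold stale values. The initial \<open>0\<close> agrees
  with \<open>best_ratio\<close> of the empty family.\<close>

lemma exec_find_extension:
  fixes \<sigma> :: "('x, 's) state"
  assumes X: "items_reg \<sigma> 0 = X" "X \<subseteq> items I" and bins: "bins I \<noteq> {}"
  defines "\<tau> \<equiv> exec I xs ss lst find_extension \<sigma>"
  shows "items_reg \<tau> 0 = X" "items_reg \<tau> 3 = items_reg \<sigma> 3"
    "bins_reg \<tau> 0 = bins_reg \<sigma> 0" "bins_reg \<tau> 2 = bins_reg \<sigma> 2" "num_reg \<tau> 0 = num_reg \<sigma> 0"
    "num_reg \<tau> 1 = best_ratio I {} X (set (lst {} X))"
    "0 < num_reg \<tau> 1 \<Longrightarrow> items_reg \<tau> 2 \<in> set (lst {} X) \<and> 0 < num_reg \<tau> 2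
      \<and> num_reg \<tau> 2 = cmin I {} (items_reg \<tau> 2)
      \<and> num_reg \<tau> 1 = ennreal (gain I X (items_reg \<tau> 2)) / num_reg \<tau> 2
      \<and> (\<exists>s\<in>bins I. bins_reg \<tau> 1 = {s} \<and> ext_cost I {} (items_reg \<tau> 2) s = num_reg \<tau> 2)"
proof -
  define L where "L = lst {} X"
  have L: "T \<subseteq> items I" if "T \<in> set L" for T
    using lst[of "{}" X] X that unfolding L_def alpha_list_def extensions_def by auto
  define h where "h = (\<lambda>T (\<tau> :: ('x, 's) state). exec I xs ss lst
       (Seq find_bin
       (IfThenElse (Conjunction (LessThan (Constant 0) (NumReg 3)) (LessThan (NumReg 1) scanned_ratio))
         (Seq (AssignNum 1 scanned_ratio)
         (Seq (AssignNum 2 (NumReg 3))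
         (Seq (AssignItems 2 (SetReg 1)) (AssignBins 1 (SetReg 3)))))
         Skip))
      (\<tau>\<lparr>items_reg := (items_reg \<tau>)(1 := T)\<rparr>))"
  define \<sigma>1 where "\<sigma>1 = \<sigma>\<lparr>num_reg := (num_reg \<sigma>)(1 := 0)\<rparr>"
  define P where "P = (\<lambda>ys (\<tau> :: ('x, 's) state).
    items_reg \<tau> 0 = X \<and> items_reg \<tau> 3 = items_reg \<sigma> 3 \<and>
    bins_reg \<tau> 0 = bins_reg \<sigma> 0 \<and> bins_reg \<tau> 2 = bins_reg \<sigma> 2 \<and> num_reg \<tau> 0 = num_reg \<sigma> 0 \<and>
    num_reg \<tau> 1 = best_ratio I {} X (set ys) \<and>
    (0 < num_reg \<tau> 1 \<longrightarrow> items_reg \<tau> 2 \<in> set ys \<and> 0 < num_reg \<tau> 2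
      \<and> num_reg \<tau> 2 = cmin I {} (items_reg \<tau> 2)
      \<and> num_reg \<tau> 1 = ennreal (gain I X (items_reg \<tau> 2)) / num_reg \<tau> 2
      \<and> (\<exists>s\<in>bins I. bins_reg \<tau> 1 = {s} \<and> ext_cost I {} (items_reg \<tau> 2) s = num_reg \<tau> 2)))"
  have "P L (fold h L \<sigma>1)"
  proof (induction rule: fold_prefix_induct)
    case Nil
    then show ?case using X by (simp add: P_def \<sigma>1_def best_ratio_def bot_ennreal)
  next
    case (snoc ys T zs \<tau>)
    have T: "T \<subseteq> items I" using L snoc by simp
    define \<tau>1 where "\<tau>1 = \<tau>\<lparr>items_reg := (items_reg \<tau>)(1 := T)\<rparr>"
    define \<tau>2 where "\<tau>2 = exec I xs ss lst find_bin \<tau>1"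
    have "items_reg \<tau>1 1 = T" unfolding \<tau>1_def by simp
    note fb = exec_find_bin[OF T this bins, folded \<tau>2_def]
    let ?r = "ennreal (gain I X T) / cmin I {} T"
    have regs: "items_reg \<tau>2 0 = X" "items_reg \<tau>2 1 = T" "num_reg \<tau>2 3 = cmin I {} T"
      using fb snoc unfolding \<tau>1_def P_def by simp_all
    \<comment> \<open>With this, the truncated difference of the two objective values is
      \<open>ennreal\<close> of the gain.\<close>
    have "0 \<le> objective I X" using I X unfolding gbsm_instance_def by simp
    then have r: "eval_num I \<tau>2 scanned_ratio = ?r"
      unfolding scanned_ratio_def gain_def by (simp add: regs ennreal_minus regs[simplified])
    have h: "h T \<tau> = (if 0 < cmin I {} T \<and> num_reg \<tau>2 1 < ?r then
        \<tau>2\<lparr>num_reg := (num_reg \<tau>2)(1 := ?r, 2 := cmin I {} T),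
          items_reg := (items_reg \<tau>2)(2 := T), bins_reg := (bins_reg \<tau>2)(1 := bins_reg \<tau>2 3)\<rparr>
        else \<tau>2)"
      unfolding h_def using r regs by (simp add: \<tau>2_def[symmetric] \<tau>1_def[simplified, symmetric] regs[simplified])
    have frame: "num_reg \<tau>2 1 = num_reg \<tau> 1" "num_reg \<tau>2 2 = num_reg \<tau> 2" "num_reg \<tau>2 0 = num_reg \<tau> 0"
      "bins_reg \<tau>2 0 = bins_reg \<tau> 0" "bins_reg \<tau>2 1 = bins_reg \<tau> 1" "bins_reg \<tau>2 2 = bins_reg \<tau> 2"
      "items_reg \<tau>2 2 = items_reg \<tau> 2" "items_reg \<tau>2 3 = items_reg \<tau> 3"
      using fb by (simp_all add: \<tau>1_def)
    have best: "best_ratio I {} X (set (ys @ [T]))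
        = (if 0 < cmin I {} T then max (best_ratio I {} X (set ys)) ?r else best_ratio I {} X (set ys))"
    proof -
      have "{T' \<in> set (ys @ [T]). 0 < cmin I {} T'}
          = (if 0 < cmin I {} T then insert T {T' \<in> set ys. 0 < cmin I {} T'}
             else {T' \<in> set ys. 0 < cmin I {} T'})" by auto
      then show ?thesis unfolding best_ratio_def by (simp add: sup_max max.commute)
    qed
    have P: "P ys \<tau>" by fact
    show ?case
    proof (cases "0 < cmin I {} T \<and> num_reg \<tau> 1 < ?r")
      case True
      then show ?thesis using P fb(5) unfolding P_def h best frame by (auto simp: regs frame max_def)
    next
      case False
      then show ?thesis using P unfolding P_def h best frame
        by (auto simp: regs frame max_def frame[simplified])
    qed
  qed
  moreover have "\<tau> = fold h L \<sigma>1"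
    unfolding \<tau>_def h_def \<sigma>1_def L_def find_extension_def by (simp add: X)
  ultimately have "P L \<tau>" by simp
  then show "items_reg \<tau> 0 = X" "items_reg \<tau> 3 = items_reg \<sigma> 3"
    "bins_reg \<tau> 0 = bins_reg \<sigma> 0" "bins_reg \<tau> 2 = bins_reg \<sigma> 2" "num_reg \<tau> 0 = num_reg \<sigma> 0"
    "num_reg \<tau> 1 = best_ratio I {} X (set (lst {} X))"
    "0 < num_reg \<tau> 1 \<Longrightarrow> items_reg \<tau> 2 \<in> set (lst {} X) \<and> 0 < num_reg \<tau> 2
      \<and> num_reg \<tau> 2 = cmin I {} (items_reg \<tau> 2)
      \<and> num_reg \<tau> 1 = ennreal (gain I X (items_reg \<tau> 2)) / num_reg \<tau> 2
      \<and> (\<exists>s\<in>bins I. bins_reg \<tau> 1 = {s} \<and> ext_cost I {} (items_reg \<tau> 2) s = num_reg \<tau> 2)"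
    unfolding P_def L_def by blast+
qed

section \<open>One round of the greedy loop\<close>

text \<open>\<open>w\<close> is the amount charged, only an upper bound on the true cost, since a
  bin chosen again is charged again. For budget \<open>0\<close> the convention
  \<open>x / 0 = 0\<close> turns the exponential into \<open>1\<close>. The last clause keeps the
  reserve affordable on its own.\<close>

definition loop_inv :: "real \<Rightarrow> ('x, 's) state \<Rightarrow> real \<Rightarrow> bool" where
  "loop_inv F \<sigma> w \<longleftrightarrow>
     items_reg \<sigma> 0 \<subseteq> items I \<and> free_items I \<subseteq> items_reg \<sigma> 0 \<and> bins_reg \<sigma> 0 \<subseteq> bins I \<and>
     (bins_reg \<sigma> 0 = {} \<longrightarrow> items_reg \<sigma> 0 = {}) \<and>
     num_reg \<sigma> 0 = ennreal w \<and> 0 \<le> w \<and> w \<le> \<beta> * budget I \<and>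
     cost I (bins_reg \<sigma> 0) (items_reg \<sigma> 0) \<le> ennreal w \<and>
     F - objective I (items_reg \<sigma> 0) \<le> exp (- \<alpha> * w / budget I) * F \<and>
     items_reg \<sigma> 3 \<subseteq> items I \<and>
     (\<exists>s\<in>bins I. bins_reg \<sigma> 2 = {s} \<and> ext_cost I {} (items_reg \<sigma> 3) s \<le> ennreal (budget I))"

definition close_enough :: "real \<Rightarrow> ('x, 's) state \<Rightarrow> bool" where
  "close_enough F \<sigma> \<longleftrightarrow>
     F - objective I (items_reg \<sigma> 0 \<union> items_reg \<sigma> 3) \<le> exp (- \<alpha> * \<beta>) * F"

lemma objective_mono: "A \<subseteq> B \<Longrightarrow> B \<subseteq> items I \<Longrightarrow> objective I A \<le> objective I B"
  using I unfolding gbsm_instance_def by blast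

text \<open>\<open>j\<close> counts completed rounds. Every round adds an item until
  \<open>close_enough\<close> holds, and from then on \<open>close_enough\<close> persists.\<close>

lemma exec_greedy_round:
  fixes \<sigma> :: "('x, 's) state"
  assumes opt: "feasible I S_opt X_opt" and inv: "loop_inv (objective I X_opt) \<sigma> w"
    and progress: "j \<le> card (items_reg \<sigma> 0) \<or> close_enough (objective I X_opt) \<sigma>"
  defines "\<tau> \<equiv> exec I xs ss lst (greedy_round \<beta>) \<sigma>"
  shows "\<exists>w'. loop_inv (objective I X_opt) \<tau> w'"
    "Suc j \<le> card (items_reg \<tau> 0) \<or> close_enough (objective I X_opt) \<tau>"
proof -
  define F X k where "F = objective I X_opt" and "X = items_reg \<sigma> 0" and "k = budget I"
  note inv = inv[folded F_def, unfolded loop_inv_def, folded X_def k_def]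
  have F: "0 \<le> F" and k: "0 \<le> k"
    using opt I unfolding F_def k_def feasible_def gbsm_instance_def by auto
  have X: "X \<subseteq> items I" and free: "free_items I \<subseteq> X" using inv by auto
  have fin: "finite (items I)" "finite (bins I)" using I unfolding gbsm_instance_def by auto
  have bins: "bins I \<noteq> {}" using opt unfolding feasible_def by auto
  define L R where "L = set (lst {} X)" and "R = best_ratio I {} X (extensions I smin {} X)"
  have "alpha_list I smin \<alpha> {} X L" unfolding L_def using lst X by simp
  then have L: "\<And>T. T \<in> L \<Longrightarrow> T \<subseteq> items I - X \<and> cmin I {} T \<le> ennreal k"
    and R: "ennreal \<alpha> * R \<le> best_ratio I {} X L"
    unfolding alpha_list_def extensions_empty[OF smin bins] R_def k_def by auto
  have gap: "ennreal (F - objective I X) \<le> R * ennreal k"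
    unfolding F_def R_def k_def using gap_le_best_ratio[OF I smin opt X free] .
  define \<sigma>1 where "\<sigma>1 = exec I xs ss lst find_extension \<sigma>"
  note ext = exec_find_extension[OF X_def[symmetric] X bins, folded \<sigma>1_def L_def]
  define T c where "T = items_reg \<sigma>1 2" and "c = enn2real (num_reg \<sigma>1 2)"
  have \<tau>: "\<tau> = (if 0 < num_reg \<sigma>1 1
      then if ennreal \<beta> * ennreal k < num_reg \<sigma>1 0 + num_reg \<sigma>1 2
        then \<sigma>1\<lparr>items_reg := (items_reg \<sigma>1)(3 := T), bins_reg := (bins_reg \<sigma>1)(2 := bins_reg \<sigma>1 1)\<rparr>
        else \<sigma>1\<lparr>items_reg := (items_reg \<sigma>1)(0 := items_reg \<sigma>1 0 \<union> T),
          bins_reg := (bins_reg \<sigma>1)(0 := bins_reg \<sigma>1 0 \<union> bins_reg \<sigma>1 1),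
          num_reg := (num_reg \<sigma>1)(0 := num_reg \<sigma>1 0 + num_reg \<sigma>1 2)\<rparr>
      else \<sigma>1)"
    unfolding \<tau>_def greedy_round_def \<sigma>1_def T_def k_def by simp
  have "(\<exists>w'. loop_inv F \<tau> w') \<and> (Suc j \<le> card (items_reg \<tau> 0) \<or> close_enough F \<tau>)"
  proof (cases "0 < num_reg \<sigma>1 1")
    case False
    then have \<tau>: "\<tau> = \<sigma>1" unfolding \<tau> by simp
    have "best_ratio I {} X L = 0" using False ext(6) by (simp add: not_gr_zero)
    \<comment> \<open>As \<open>\<alpha>\<close> is positive, a list without positive ratio means
      that no extension has one; the averaging bound then closes the gap.\<close>
    then have "R = 0" using R \<alpha> by (simp add: ennreal_eq_0_iff)
    then have "F \<le> objective I X" using gap by (simp add: ennreal_eq_0_iff)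
    also have "\<dots> \<le> objective I (X \<union> items_reg \<sigma> 3)" using inv by (intro objective_mono) auto
    finally have "F - objective I (X \<union> items_reg \<sigma> 3) \<le> exp (- \<alpha> * \<beta>) * F"
      using F by (smt (verit) exp_ge_zero mult_nonneg_nonneg)
    then have "close_enough F \<tau>" unfolding close_enough_def \<tau> ext by simp
    moreover have "loop_inv F \<tau> w" unfolding loop_inv_def \<tau> ext using inv unfolding k_def by blast
    ultimately show ?thesis by blast
  next
    case True
    from ext(7)[OF True, folded T_def] obtain s where
      TL: "T \<in> L" and pos: "0 < num_reg \<sigma>1 2" and c2: "num_reg \<sigma>1 2 = cmin I {} T"
      and ratio: "num_reg \<sigma>1 1 = ennreal (gain I X T) / num_reg \<sigma>1 2"
      and s: "s \<in> bins I" "bins_reg \<sigma>1 1 = {s}" "ext_cost I {} T s = num_reg \<sigma>1 2"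
      by blast
    have T: "T \<subseteq> items I - X" and ck: "num_reg \<sigma>1 2 \<le> ennreal k" using L[OF TL] c2 by auto
    have "num_reg \<sigma>1 2 < top" using ck le_less_trans by fastforce
    then have c: "num_reg \<sigma>1 2 = ennreal c" "0 < c"
      using pos unfolding c_def by (auto simp: enn2real_positive_iff)
    \<comment> \<open>A positive cost within the budget excludes budget \<open>0\<close>, so
      division by \<open>k\<close> is genuine.\<close>
    have "c \<le> k" using ck c k by simp
    then have kpos: "0 < k" using c by simp
    have g: "0 \<le> gain I X T" using T by (intro gain_nonneg[OF I X]) auto
    \<comment> \<open>Shown before testing whether \<open>T\<close> fits: it renews the invariant if
      \<open>T\<close> is added and yields \<open>close_enough\<close> if \<open>T\<close>
      overflows.\<close>
    have decay: "F - objective I X - gain I X T \<le> exp (- \<alpha> * (w + c) / k) * F"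
    proof (rule gap_decay[OF gap _ c(2) kpos \<alpha> g F])
      show "ennreal \<alpha> * R \<le> ennreal (gain I X T) / ennreal c" using R ext(6) ratio c(1) by simp
      show "F - objective I X \<le> exp (- \<alpha> * w / k) * F" using inv by blast
    qed
    have gT: "objective I X + gain I X T = objective I (X \<union> T)" unfolding gain_def by simp
    have w: "0 \<le> w" "w \<le> \<beta> * k" "num_reg \<sigma>1 0 = ennreal w" using inv ext(5) by auto
    have over: "ennreal \<beta> * ennreal k < num_reg \<sigma>1 0 + num_reg \<sigma>1 2 \<longleftrightarrow> \<beta> * k < w + c"
      using w c kpos \<beta> by (simp add: ennreal_mult[symmetric] ennreal_plus[symmetric] ennreal_less_iff del: ennreal_plus)
    show ?thesis
    proof (cases "\<beta> * k < w + c")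
      case overflow: True
      then have \<tau>: "\<tau> = \<sigma>1\<lparr>items_reg := (items_reg \<sigma>1)(3 := T), bins_reg := (bins_reg \<sigma>1)(2 := {s})\<rparr>"
        unfolding \<tau> using True over s by simp
      have "loop_inv F \<tau> w" unfolding loop_inv_def \<tau> using inv ext s ck T by (auto simp: k_def X_def)
      \<comment> \<open>Overflow means \<open>w + c > \<beta> * k\<close>, which pushes the decay
        exponent past \<open>\<alpha> * \<beta>\<close>.\<close>
      moreover have "\<alpha> * \<beta> \<le> \<alpha> * (w + c) / k"
        using overflow kpos \<alpha> by (simp add: pos_le_divide_eq mult.assoc)
      then have "exp (- \<alpha> * (w + c) / k) * F \<le> exp (- \<alpha> * \<beta>) * F"
        using F by (intro mult_right_mono) auto
      then have "close_enough F \<tau>"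
        unfolding close_enough_def \<tau> using decay gT ext(1) by simp
      ultimately show ?thesis by blast
    next
      case False
      then have \<tau>: "\<tau> = \<sigma>1\<lparr>items_reg := (items_reg \<sigma>1)(0 := X \<union> T),
          bins_reg := (bins_reg \<sigma>1)(0 := bins_reg \<sigma>1 0 \<union> {s}), num_reg := (num_reg \<sigma>1)(0 := ennreal (w + c))\<rparr>"
        unfolding \<tau> using True over s ext(1) w c by (simp add: ennreal_plus)
      have "cost I (bins_reg \<sigma> 0 \<union> {s}) (X \<union> T) \<le> cost I (bins_reg \<sigma> 0) X + ext_cost I {} T s"
        using inv T X fin by (intro cost_Un_le) (auto intro: finite_subset)
      also have "\<dots> \<le> ennreal w + ennreal c" using inv s c(1) by (intro add_mono) auto
      finally have cost: "cost I (insert s (bins_reg \<sigma> 0)) (X \<union> T) \<le> ennreal (w + c)"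
        using w c by (simp add: ennreal_plus)
      have "loop_inv F \<tau> (w + c)"
        unfolding loop_inv_def \<tau> using inv ext(2,3,4) cost decay gT T X False c w s
        by (auto simp: k_def diff_diff_eq)
      moreover have "Suc j \<le> card (items_reg \<tau> 0) \<or> close_enough F \<tau>"
      proof (cases "j \<le> card X")
        case True
        \<comment> \<open>The empty set has gain \<open>0\<close>, contradicting the positive ratio;
          as \<open>T\<close> is disjoint from \<open>X\<close>, the solution grows
          strictly.\<close>
        have "T \<noteq> {}" using \<open>0 < num_reg \<sigma>1 1\<close> ratio by (auto simp: gain_def)
        then have "card X < card (X \<union> T)"
          using T X fin by (intro psubset_card_mono) (auto intro: finite_subset)
        then show ?thesis using True unfolding \<tau> by simp
      next
        case False
        \<comment> \<open>The reserve is unchanged in this branch and the solution only grows, so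
          closeness is preserved.\<close>
        have "objective I (X \<union> items_reg \<sigma> 3) \<le> objective I (X \<union> T \<union> items_reg \<sigma> 3)"
          using inv X T by (intro objective_mono) auto
        moreover have "close_enough F \<sigma>" using False progress unfolding F_def X_def by simp
        ultimately have "close_enough F \<tau>" unfolding close_enough_def \<tau>
          by (simp add: ext X_def[symmetric])
        then show ?thesis by simp
      qed
      ultimately show ?thesis by blast
    qed
  qed
  then show "\<exists>w'. loop_inv (objective I X_opt) \<tau> w'"
    "Suc j \<le> card (items_reg \<tau> 0) \<or> close_enough (objective I X_opt) \<tau>"
    unfolding F_def by auto
qed

section \<open>Initialization: a reserve bin and the free items\<close>

lemma exec_reserve_bin:
  fixes \<sigma> :: "('x, 's) state"
  assumes cheap: "s \<in> bins I" "bin_cost I s \<le> budget I"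
  defines "\<tau> \<equiv> exec I xs ss lst reserve_bin \<sigma>"
  shows "items_reg \<tau> = items_reg \<sigma>" "num_reg \<tau> = num_reg \<sigma>" "bins_reg \<tau> 0 = bins_reg \<sigma> 0"
    "\<exists>s\<in>bins I. bins_reg \<tau> 2 = {s} \<and> bin_cost I s \<le> budget I"
proof -
  define P where "P = (\<lambda>ys (\<tau> :: ('x, 's) state).
    items_reg \<tau> = items_reg \<sigma> \<and> num_reg \<tau> = num_reg \<sigma> \<and> bins_reg \<tau> 0 = bins_reg \<sigma> 0 \<and>
    ((\<exists>s\<in>set ys. bin_cost I s \<le> budget I) \<longrightarrow>
      (\<exists>s\<in>bins I. bins_reg \<tau> 2 = {s} \<and> bin_cost I s \<le> budget I)))"
  have "P ss \<tau>"
    unfolding \<tau>_def reserve_bin_def exec.simps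
  proof (induction rule: fold_prefix_induct)
    case Nil
    then show ?case by (simp add: P_def)
  next
    case (snoc ys s zs \<tau>)
    have "s \<in> bins I" using snoc ss by auto
    moreover have "0 \<le> budget I" "0 \<le> bin_cost I s"
      using I \<open>s \<in> bins I\<close> unfolding gbsm_instance_def by auto
    ultimately show ?case using snoc(2) unfolding P_def by (auto simp: ennreal_less_iff)
  qed
  then show "items_reg \<tau> = items_reg \<sigma>" "num_reg \<tau> = num_reg \<sigma>" "bins_reg \<tau> 0 = bins_reg \<sigma> 0"
    "\<exists>s\<in>bins I. bins_reg \<tau> 2 = {s} \<and> bin_cost I s \<le> budget I"
    using cheap unfolding P_def ss by blast+
qed

lemma exec_add_free_of_bin:
  fixes \<sigma> :: "('x, 's) state"
  assumes s: "bin_reg \<sigma> 0 = s" "s \<in> bins I" "bin_cost I s = 0"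
    and \<sigma>: "items_reg \<sigma> 0 \<subseteq> items I" "bins_reg \<sigma> 0 \<subseteq> bins I"
      "cost I (bins_reg \<sigma> 0) (items_reg \<sigma> 0) = 0"
  defines "\<tau> \<equiv> exec I xs ss lst add_free_of_bin \<sigma>"
  shows "num_reg \<tau> = num_reg \<sigma>" "items_reg \<tau> 3 = items_reg \<sigma> 3" "bins_reg \<tau> 2 = bins_reg \<sigma> 2"
    "bins_reg \<tau> 0 = bins_reg \<sigma> 0 \<union> {s}" "items_reg \<tau> 0 \<subseteq> items I"
    "cost I (bins_reg \<tau> 0) (items_reg \<tau> 0) = 0"
    "items_reg \<sigma> 0 \<union> {x \<in> items I. assoc_cost I s x = 0} \<subseteq> items_reg \<tau> 0"
proof -
  have fin: "finite (items I)" "finite (bins I)" using I unfolding gbsm_instance_def by auto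
  define S where "S = bins_reg \<sigma> 0 \<union> {s}"
  have S: "S \<subseteq> bins I" "S \<union> {s} = S" using s \<sigma> unfolding S_def by auto
  \<comment> \<open>Applied first with \<open>T = {}\<close> to open \<open>s\<close>, then with
    single items and a bin set already containing \<open>s\<close>, where
    \<open>S \<union> {s} = S\<close>.\<close>
  have step: "cost I (A \<union> {s}) (X \<union> T) = 0"
    if "cost I A X = 0" "A \<subseteq> bins I" "X \<subseteq> items I" "finite T" "\<forall>x\<in>T. assoc_cost I s x = 0" for A X T
  proof -
    have "cost I (A \<union> {s}) (X \<union> T) \<le> cost I A X + ext_cost I {} T s"
      using that fin by (intro cost_Un_le) (auto intro: finite_subset)
    also have "ext_cost I {} T s = 0"
      using that s unfolding ext_cost_def residual_bin_cost_def by simp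
    finally show ?thesis using that by simp
  qed
  define P where "P = (\<lambda>ys (\<tau> :: ('x, 's) state).
    num_reg \<tau> = num_reg \<sigma> \<and> items_reg \<tau> 3 = items_reg \<sigma> 3 \<and> bins_reg \<tau> 2 = bins_reg \<sigma> 2 \<and>
    bin_reg \<tau> 0 = s \<and> bins_reg \<tau> 0 = S \<and> items_reg \<tau> 0 \<subseteq> items I \<and>
    cost I S (items_reg \<tau> 0) = 0 \<and>
    items_reg \<sigma> 0 \<union> {x \<in> set ys. assoc_cost I s x = 0} \<subseteq> items_reg \<tau> 0)"
  have "P xs \<tau>"
    unfolding \<tau>_def add_free_of_bin_def exec.simps
  proof (induction rule: fold_prefix_induct)
    case Nil
    then show ?case
      using s \<sigma> step[OF \<sigma>(3,2,1), of "{}"] unfolding P_def S_def by simp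
  next
    case (snoc ys x zs \<tau>)
    have x: "x \<in> items I" using snoc xs by auto
    show ?case
    proof (cases "assoc_cost I s x = 0")
      case True
      have "cost I (S \<union> {s}) (items_reg \<tau> 0 \<union> {x}) = 0"
        using snoc(2) S True unfolding P_def by (intro step) auto
      then show ?thesis using snoc(2) True x unfolding S(2) P_def by auto
    next
      case False
      then show ?thesis using snoc(2) x unfolding P_def by (auto simp: zero_less_iff_neq_zero)
    qed
  qed
  then show "num_reg \<tau> = num_reg \<sigma>" "items_reg \<tau> 3 = items_reg \<sigma> 3" "bins_reg \<tau> 2 = bins_reg \<sigma> 2"
    "bins_reg \<tau> 0 = bins_reg \<sigma> 0 \<union> {s}" "items_reg \<tau> 0 \<subseteq> items I"
    "cost I (bins_reg \<tau> 0) (items_reg \<tau> 0) = 0"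
    "items_reg \<sigma> 0 \<union> {x \<in> items I. assoc_cost I s x = 0} \<subseteq> items_reg \<tau> 0"
    unfolding P_def S_def xs by auto
qed

lemma exec_add_free:
  fixes \<sigma> :: "('x, 's) state"
  assumes \<sigma>: "items_reg \<sigma> 0 = {}" "bins_reg \<sigma> 0 = {}"
  defines "\<tau> \<equiv> exec I xs ss lst add_free \<sigma>"
  shows "num_reg \<tau> = num_reg \<sigma>" "items_reg \<tau> 3 = items_reg \<sigma> 3" "bins_reg \<tau> 2 = bins_reg \<sigma> 2"
    "bins_reg \<tau> 0 \<subseteq> bins I" "items_reg \<tau> 0 \<subseteq> items I" "bins_reg \<tau> 0 = {} \<Longrightarrow> items_reg \<tau> 0 = {}"
    "cost I (bins_reg \<tau> 0) (items_reg \<tau> 0) = 0" "free_items I \<subseteq> items_reg \<tau> 0"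
proof -
  define P where "P = (\<lambda>ys (\<tau> :: ('x, 's) state).
    num_reg \<tau> = num_reg \<sigma> \<and> items_reg \<tau> 3 = items_reg \<sigma> 3 \<and> bins_reg \<tau> 2 = bins_reg \<sigma> 2 \<and>
    bins_reg \<tau> 0 \<subseteq> bins I \<and> items_reg \<tau> 0 \<subseteq> items I \<and>
    (bins_reg \<tau> 0 = {} \<longrightarrow> items_reg \<tau> 0 = {}) \<and>
    cost I (bins_reg \<tau> 0) (items_reg \<tau> 0) = 0 \<and>
    {x \<in> items I. \<exists>s\<in>set ys. bin_cost I s = 0 \<and> assoc_cost I s x = 0} \<subseteq> items_reg \<tau> 0)"
  have "P ss \<tau>"
    unfolding \<tau>_def add_free_def exec.simps
  proof (induction rule: fold_prefix_induct)
    case Nil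
    then show ?case using \<sigma> by (simp add: P_def cost_def)
  next
    case (snoc ys s zs \<tau>)
    have s: "s \<in> bins I" using snoc ss by auto
    then have c: "0 \<le> bin_cost I s" using I unfolding gbsm_instance_def by auto
    define \<tau>1 where "\<tau>1 = \<tau>\<lparr>bin_reg := (bin_reg \<tau>)(0 := s)\<rparr>"
    have \<tau>1: "num_reg \<tau>1 = num_reg \<tau>" "items_reg \<tau>1 = items_reg \<tau>" "bins_reg \<tau>1 = bins_reg \<tau>"
      "bin_reg \<tau>1 0 = s"
      unfolding \<tau>1_def by simp_all
    show ?case
    proof (cases "bin_cost I s = 0")
      case True
      have "items_reg \<tau>1 0 \<subseteq> items I" "bins_reg \<tau>1 0 \<subseteq> bins I"
        "cost I (bins_reg \<tau>1 0) (items_reg \<tau>1 0) = 0"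
        using snoc(2) unfolding \<tau>1 P_def by auto
      note free = exec_add_free_of_bin[OF \<tau>1(4) s True this, unfolded \<tau>1]
      have "P (ys @ [s]) (exec I xs ss lst add_free_of_bin \<tau>1)"
        using snoc(2) free(5-7) s unfolding P_def free(1-4) by auto
      then show ?thesis using True by (simp add: \<tau>1_def)
    next
      case False
      then show ?thesis using snoc(2) c unfolding P_def by auto
    qed
  qed
  then show "num_reg \<tau> = num_reg \<sigma>" "items_reg \<tau> 3 = items_reg \<sigma> 3" "bins_reg \<tau> 2 = bins_reg \<sigma> 2"
    "bins_reg \<tau> 0 \<subseteq> bins I" "items_reg \<tau> 0 \<subseteq> items I" "bins_reg \<tau> 0 = {} \<Longrightarrow> items_reg \<tau> 0 = {}"
    "cost I (bins_reg \<tau> 0) (items_reg \<tau> 0) = 0" "free_items I \<subseteq> items_reg \<tau> 0"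
    unfolding P_def free_items_def ss by auto
qed

section \<open>The approximation guarantee\<close>

lemma greedy_approximation:
  assumes opt: "feasible I S_opt X_opt" and res: "run I xs ss lst (greedy \<beta>) = (S, X)"
  shows "S \<subseteq> bins I" "S \<noteq> {}" "X \<subseteq> items I" "cost I S X \<le> ennreal (\<beta> * budget I)"
    "1 / 2 * (1 - exp (- \<alpha> * \<beta>)) * objective I X_opt \<le> objective I X"
proof -
  define F k where "F = objective I X_opt" and "k = budget I"
  have F: "0 \<le> F" and k: "0 \<le> k"
    using opt I unfolding F_def k_def feasible_def gbsm_instance_def by auto
  have fin: "finite (items I)" "finite (bins I)" using I unfolding gbsm_instance_def by auto
  have S_opt: "S_opt \<subseteq> bins I" "S_opt \<noteq> {}" "X_opt \<subseteq> items I" "cost I S_opt X_opt \<le> ennreal k"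
    using opt unfolding feasible_def k_def by auto
  then obtain s where s: "s \<in> S_opt" "s \<in> bins I" by auto
  \<comment> \<open>Every bin of a feasible solution is affordable, so \<open>reserve_bin\<close>
    finds one.\<close>
  have "ennreal (bin_cost I s) \<le> (\<Sum>s\<in>S_opt. ennreal (bin_cost I s))"
    using s S_opt fin by (intro member_le_sum) (auto intro: finite_subset)
  also have "\<dots> \<le> cost I S_opt X_opt" unfolding cost_def by simp
  finally have cheap: "bin_cost I s \<le> budget I"
    using S_opt(4) k unfolding k_def by (meson ennreal_le_iff order_trans)
  define \<sigma>1 where "\<sigma>1 = exec I xs ss lst reserve_bin initial_state"
  define \<sigma>2 where "\<sigma>2 = exec I xs ss lst add_free \<sigma>1"
  define \<sigma>3 where "\<sigma>3 = exec I xs ss lst (ForItem 1 (greedy_round \<beta>)) \<sigma>2"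
  note 1 = exec_reserve_bin[OF s(2) cheap, of initial_state, folded \<sigma>1_def]
  have "items_reg \<sigma>1 0 = {}" "bins_reg \<sigma>1 0 = {}" using 1 by (auto simp: initial_state_def)
  note 2 = exec_add_free[OF this, folded \<sigma>2_def]
  have nonneg: "0 \<le> objective I A" if "A \<subseteq> items I" for A
    using I that unfolding gbsm_instance_def by blast
  \<comment> \<open>At \<open>w = 0\<close> the exponential is \<open>1\<close>, and the gap
    condition reduces to nonnegativity of the objective. The reserve has no items yet and costs only
    its bin.\<close>
  have init: "loop_inv F \<sigma>2 0"
    using 1 2 k \<beta> nonneg[OF 2(5)] unfolding loop_inv_def k_def[symmetric]
    by (auto simp: initial_state_def ext_cost_def residual_bin_cost_def intro!: ennreal_leI)
  define P where "P = (\<lambda>ys :: 'x list. \<lambda>\<tau>. (\<exists>w. loop_inv F \<tau> w) \<and>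
    (length ys \<le> card (items_reg \<tau> 0) \<or> close_enough F \<tau>))"
  have "P xs \<sigma>3"
    unfolding \<sigma>3_def exec.simps
  proof (induction rule: fold_prefix_induct)
    case Nil
    then show ?case using init unfolding P_def by auto
  next
    case (snoc ys x zs \<tau>)
    let ?\<tau> = "\<tau>\<lparr>item_reg := (item_reg \<tau>)(1 := x)\<rparr>"
    obtain w where "loop_inv F ?\<tau> w" using snoc(2) unfolding P_def loop_inv_def by auto
    moreover have "length ys \<le> card (items_reg ?\<tau> 0) \<or> close_enough F ?\<tau>"
      using snoc(2) unfolding P_def close_enough_def by simp
    ultimately show ?case using exec_greedy_round[OF opt, of ?\<tau> w "length ys"]
      unfolding P_def F_def by simp
  qed
  then obtain w where inv: "loop_inv F \<sigma>3 w"
    and enough: "length xs \<le> card (items_reg \<sigma>3 0) \<or> close_enough F \<sigma>3"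
    unfolding P_def by auto
  define A B where "A = items_reg \<sigma>3 0" and "B = items_reg \<sigma>3 3"
  note inv = inv[unfolded loop_inv_def, folded A_def B_def k_def]
  have AB: "A \<subseteq> items I" "B \<subseteq> items I" using inv by auto
  have "F - objective I (A \<union> B) \<le> exp (- \<alpha> * \<beta>) * F"
    using enough
  proof
    \<comment> \<open>If every round added an item, all items have been collected.\<close>
    assume "length xs \<le> card (items_reg \<sigma>3 0)"
    then have "card (items I) \<le> card A" using distinct_card[OF xs(1)] xs(2) unfolding A_def by simp
    then have "A = items I" using AB fin by (simp add: card_seteq)
    then have "F \<le> objective I (A \<union> B)" unfolding F_def using S_opt AB by (intro objective_mono) auto
    then show ?thesis using F by (smt (verit) exp_ge_zero mult_nonneg_nonneg)
  qed (simp add: close_enough_def A_def B_def)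
  \<comment> \<open>Source of the factor \<open>1 / 2\<close>: the better of \<open>A\<close> and
    \<open>B\<close> is worth at least half of their union.\<close>
  moreover have "objective I (A \<union> B) \<le> objective I A + objective I B"
    using I AB nonneg[of "A \<inter> B"] unfolding gbsm_instance_def by (smt (verit) inf.coboundedI1)
  ultimately have AB_le: "(1 - exp (- \<alpha> * \<beta>)) * F \<le> objective I A + objective I B"
    by (simp add: left_diff_distrib)
  have "(S, X) = (if objective I B < objective I A then (bins_reg \<sigma>3 0, A) else (bins_reg \<sigma>3 2, B))"
    using res nonneg[OF AB(1)] nonneg[OF AB(2)]
    unfolding run_def greedy_def A_def B_def \<sigma>3_def \<sigma>2_def \<sigma>1_def
    by (simp add: ennreal_less_iff Let_def split: if_splits)
  then consider "objective I B < objective I A" "S = bins_reg \<sigma>3 0" "X = A"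
    | "objective I A \<le> objective I B" "S = bins_reg \<sigma>3 2" "X = B"
    by (auto split: if_splits)
  then have "S \<subseteq> bins I \<and> S \<noteq> {} \<and> X \<subseteq> items I \<and> cost I S X \<le> ennreal (\<beta> * k)
    \<and> 1 / 2 * (1 - exp (- \<alpha> * \<beta>)) * F \<le> objective I X"
  proof cases
    case 1
    \<comment> \<open>A strict win over \<open>B\<close> rules out the empty set, and by the
      invariant a nonempty item set comes with a nonempty bin set.\<close>
    have "A \<noteq> {}" using 1 objective_mono[of "{}" B] AB by auto
    then have "S \<noteq> {}" using inv 1 by (auto simp: A_def)
    moreover have "cost I S X \<le> ennreal (\<beta> * k)"
      using inv 1 by (meson ennreal_leI order_trans)
    moreover have "1 / 2 * (1 - exp (- \<alpha> * \<beta>)) * F \<le> objective I X" using 1 AB_le by simp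
    ultimately show ?thesis using inv 1 by simp
  next
    case 2
    obtain s where reserve: "s \<in> bins I" "bins_reg \<sigma>3 2 = {s}" "ext_cost I {} B s \<le> ennreal k"
      using inv by blast
    have "k \<le> \<beta> * k" using \<beta> k by (simp add: mult_le_cancel_right1)
    then have "ennreal k \<le> ennreal (\<beta> * k)" by (rule ennreal_leI)
    then have "cost I S X \<le> ennreal (\<beta> * k)" "S \<subseteq> bins I" "S \<noteq> {}"
      using reserve unfolding 2 by (auto simp: cost_singleton intro: order_trans)
    moreover have "1 / 2 * (1 - exp (- \<alpha> * \<beta>)) * F \<le> objective I X" using 2 AB_le by simp
    ultimately show ?thesis using AB 2 by simp
  qed
  then show "S \<subseteq> bins I" "S \<noteq> {}" "X \<subseteq> items I" "cost I S X \<le> ennreal (\<beta> * budget I)"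
    "1 / 2 * (1 - exp (- \<alpha> * \<beta>)) * objective I X_opt \<le> objective I X"
    unfolding k_def F_def by auto
qed

end

text \<open>The witness \<open>greedy \<beta>\<close> is fixed before the instance and built from
  \<open>\<beta>\<close> alone; \<open>\<alpha>\<close> enters through the analysis.\<close>

theorem theorem5:
  fixes \<alpha> \<beta> :: real
  assumes "0 < \<alpha>" and "\<alpha> \<le> 1" and "1 \<le> \<beta>"
  shows "\<exists>p. \<forall>(I :: ('x, 's) gbsm) xs ss smin lst.
    gbsm_instance I \<longrightarrow>
    distinct xs \<longrightarrow> set xs = items I \<longrightarrow>
    distinct ss \<longrightarrow> set ss = bins I \<longrightarrow>
    is_smin I smin \<longrightarrow>
    (\<forall>S' X'. S' \<subseteq> bins I \<longrightarrow> X' \<subseteq> items I \<longrightarrow> alpha_list I smin \<alpha> S' X' (set (lst S' X'))) \<longrightarrow>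
    bicriterion_solution I (1 / 2 * (1 - 1 / exp (\<alpha> * \<beta>))) \<beta> (run I xs ss lst p)"
proof (intro exI[of _ "greedy \<beta>"] allI impI)
  fix I :: "('x, 's) gbsm" and xs ss smin lst
  assume "gbsm_instance I" "distinct xs" "set xs = items I" "distinct ss" "set ss = bins I"
    "is_smin I smin"
    "\<forall>S' X'. S' \<subseteq> bins I \<longrightarrow> X' \<subseteq> items I \<longrightarrow> alpha_list I smin \<alpha> S' X' (set (lst S' X'))"
  then interpret greedy_input I xs ss smin lst \<alpha> \<beta>
    using assms by unfold_locales auto
  obtain S X where res: "run I xs ss lst (greedy \<beta>) = (S, X)" by fastforce
  show "bicriterion_solution I (1 / 2 * (1 - 1 / exp (\<alpha> * \<beta>))) \<beta> (run I xs ss lst (greedy \<beta>))"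
    unfolding res bicriterion_solution_def optimal_def split
  proof (intro allI impI, elim conjE, goal_cases)
    case (1 S_opt X_opt)
    show ?case using greedy_approximation[OF 1(1) res] by (simp add: exp_minus inverse_eq_divide)
  qed
qed

end
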